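(* Let $N>2$, $m_c=(N-2)/N$, and for $m>m_c$ let $B_m(x,t;M)$ denote the fundamental solution of $\partial_t u=\Delta(u^m)$ in $\mathbb{R}^N$ with mass $M>0$. Then as $m\downarrow m_c$, for every $t>0$, $$\lim_{m\to m_c}B_m(\cdot,t;M)=M\,\delta$$ in the sense of measures in $\mathbb{R}^N$, where $\delta$ is the unit Dirac mass at $x=0$. Moreover, outside any ball $B_R(0)$, $R>0$, the convergence of $B_m(\cdot,t;M)$ to zero is uniform, thanks to the estimate $$B_m(x,t;M)\le C(N)\,\varepsilon^{\frac1{1-m}}\,|x|^{-\frac{2}{1-m}}\,t^{\frac1{1-m}},\qquad x\ne0,\ t>0,$$ valid for $\varepsilon=m-m_c>0$ small, with a constant $C(N)$ depending only on $N$.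
   Context: For $m_c<m<1$ the fundamental (Barenblatt) solution with mass $M$ is $$B_m(x,t;M)=t^{-\alpha}\Bigl(C+\tfrac{\beta(1-m)}{2m}\,\tfrac{|x|^2}{t^{2\beta}}\Bigr)^{-\frac1{1-m}},\qquad \alpha=\frac{N}{2-N(1-m)},\quad \beta=\frac{\alpha}{N},$$ where $C=C(m,N,M)>0$ is determined by $\int_{\mathbb{R}^N}B_m(x,t;M)\,dx=M$ (independent of $t$). *)

theory Defs
  imports "HOL-Probability.Probability"
begin

definition m_crit :: "nat \<Rightarrow> real" where
  "m_crit N = (real N - 2) / real N"

definition bar_alpha :: "nat \<Rightarrow> real \<Rightarrow> real" where
  "bar_alpha N m = real N / (2 - real N * (1 - m))"

definition bar_beta :: "nat \<Rightarrow> real \<Rightarrow> real" where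
  "bar_beta N m = bar_alpha N m / real N"

text \<open>The Barenblatt family of explicit solutions of \<open>u\<^sub>t = \<Delta>(u\<^sup>m)\<close>, \<open>m_crit N < m < 1\<close>. The free
  constant \<open>C > 0\<close> is fixed afterwards by prescribing the mass \<open>M\<close>; the result is the
  fundamental solution with initial trace \<open>M\<close> times the unit Dirac mass at the origin.\<close>

definition barenblatt_profile :: "real \<Rightarrow> real \<Rightarrow> real \<Rightarrow> real ^ 'n \<Rightarrow> real" where
  "barenblatt_profile C m t x =
     t powr (- bar_alpha CARD('n) m) *
     (C + bar_beta CARD('n) m * (1 - m) / (2 * m) * ((norm x)\<^sup>2 / t powr (2 * bar_beta CARD('n) m)))
       powr (- 1 / (1 - m))"

text \<open>For \<open>N > 2\<close> and \<open>m_crit N < m < 1\<close> the exponent \<open>2 / (1 - m)\<close> exceeds \<open>N\<close>, so the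
  profile is integrable; its mass does not depend on \<open>t\<close> and decreases strictly and continuously
  from \<open>\<infinity>\<close> to \<open>0\<close> as \<open>C\<close> runs through \<open>(0, \<infinity>)\<close>. Hence the description below is
  proper for every \<open>M > 0\<close>. Outside this range of \<open>m\<close> nothing is intended.\<close>

definition barenblatt_const :: "'n::finite itself \<Rightarrow> real \<Rightarrow> real \<Rightarrow> real" where
  "barenblatt_const _ m M =
     (THE C. C > 0 \<and>
        (\<forall>t>0. has_bochner_integral lborel (barenblatt_profile C m t :: real ^ 'n \<Rightarrow> real) M))"

definition barenblatt :: "real \<Rightarrow> real \<Rightarrow> real \<Rightarrow> real ^ 'n \<Rightarrow> real" where
  "barenblatt m M t = barenblatt_profile (barenblatt_const TYPE('n) m M) m t"

text \<open>Weak convergence of finite Borel measures, tested against all bounded continuous functions.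
  This contains the convergence against continuous functions of compact support (and, for constant
  total mass, both notions agree). Finiteness is demanded so that no test integral takes the
  default value of a non-integrable function.\<close>

definition weak_conv_measures ::
    "('i \<Rightarrow> 'a::topological_space measure) \<Rightarrow> 'a measure \<Rightarrow> 'i filter \<Rightarrow> bool" where
  "weak_conv_measures \<mu> \<nu> F \<longleftrightarrow>
     (\<forall>\<^sub>F i in F. finite_measure (\<mu> i) \<and> sets (\<mu> i) = sets borel) \<and>
     finite_measure \<nu> \<and> sets \<nu> = sets borel \<and>
     (\<forall>f :: 'a \<Rightarrow> real. continuous_on UNIV f \<and> bounded (range f) \<longrightarrow>
        ((\<lambda>i. integral\<^sup>L (\<mu> i) f) \<longlongrightarrow> integral\<^sup>L \<nu> f) F)"

end

theory Submission
  imports Defs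
begin

text \<open>
  Write \<open>\<epsilon> = m - m\<^sub>c\<close> and \<open>p = 1 / (1 - m)\<close>. Then \<open>\<alpha> = 1 / \<epsilon>\<close>, \<open>\<beta> = 1 / (N \<epsilon>)\<close>, and the factor
  of \<open>|x|\<^sup>2\<close> in the Barenblatt solution is \<open>\<kappa> t^(- 2 \<beta>)\<close> with
  \<open>\<kappa> = (1 - m) / (2 m N \<epsilon>)\<close>, which blows up like \<open>1 / \<epsilon>\<close>. Dropping the constant \<open>C > 0\<close> inside the
  negative power \<open>-p\<close> leaves a pure power law: the exponents of \<open>t\<close> collapse to
  \<open>2 \<beta> p - \<alpha> = p\<close>, and \<open>\<kappa>^(- p)\<close> supplies the small factor \<open>\<epsilon>^p\<close>,
  with a coefficient that stays bounded as \<open>m\<close> decreases to \<open>m\<^sub>c\<close>. This is the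
  pointwise estimate (\<open>barenblatt_le\<close>); it does not involve the mass \<open>M\<close>, and the uniform convergence
  to \<open>0\<close> away from the origin follows at once.

  For the convergence of measures, the mass is \<open>M\<close> for every \<open>m\<close>, so it suffices that the mass outside
  each ball vanishes (\<open>weak_conv_measures_point_mass\<close>). The pointwise bound is integrable at
  infinity, but only barely: \<open>2 p - N = N \<epsilon> / (1 - m)\<close> tends to \<open>0\<close>, so that the tail integral of
  \<open>|x|^(- 2 p)\<close> is of order \<open>1 / \<epsilon>\<close>. The outer mass is therefore at most of order \<open>\<epsilon>^(p - 1)\<close>,
  which tends to \<open>0\<close> because \<open>p\<close> tends to \<open>N / 2\<close> and \<open>N > 2\<close> (\<open>tendsto_barenblatt_tail\<close>).

  Both arguments presuppose that the constant \<open>C\<close> is well defined and positive. A rescaling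
  of \<open>x\<close> turns every profile into the fixed function \<open>(1 + |x|\<^sup>2)^(- p)\<close>, so that its mass is a
  positive factor times \<open>C^(N / 2 - p)\<close>, independently of \<open>t\<close>. This exponent is negative, so each
  mass is attained for exactly one \<open>C\<close> (\<open>barenblatt_const\<close>).
\<close>

section \<open>Power tails in Euclidean space\<close>

text \<open>The sum of a geometric series with ratio \<open>2^(- d)\<close>: convexity of the
  exponential function and \<open>ln 2 \<ge> 1/2\<close> show that it is of order \<open>1 / d\<close> for small \<open>d\<close>.\<close>

lemma inverse_one_minus_two_powr_le:
  fixes d :: real
  assumes "d > 0"
  shows "2 powr (- d) < 1" "1 / (1 - 2 powr (- d)) \<le> 1 + 2 / d"
proof -
  have "ln (1/2 :: real) \<le> 1/2 - 1" by (rule ln_le_minus_one) simp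
  then have "ln (2::real) \<ge> 1/2" by (simp add: ln_div)
  then have "1 + d / 2 \<le> 1 + d * ln 2" using assms by (simp add: field_simps)
  also have "\<dots> \<le> exp (d * ln 2)" by (rule exp_ge_add_one_self)
  finally have "1 + d / 2 \<le> 2 powr d" by (simp add: powr_def)
  then have "2 powr (- d) \<le> 1 / (1 + d / 2)"
    using assms by (simp add: powr_minus field_simps)
  then have *: "1 - 2 powr (- d) \<ge> (d / 2) / (1 + d / 2)"
    using assms by (simp add: field_simps)
  have pos: "(d / 2) / (1 + d / 2) > 0" using assms by simp
  show "2 powr (- d) < 1" using * pos by linarith
  have "1 / (1 - 2 powr (- d)) \<le> 1 / ((d / 2) / (1 + d / 2))"
    by (rule frac_le[OF _ order_refl pos *]) simp
  also have "\<dots> = 1 + 2 / d" using assms by (simp add: field_simps)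
  finally show "1 / (1 - 2 powr (- d)) \<le> 1 + 2 / d" .
qed

lemma ex_dyadic_scale:
  fixes y :: real
  assumes "1 \<le> y"
  obtains n where "2 ^ n \<le> y" "y < 2 ^ Suc n"
proof -
  obtain k0 where "y < 2 ^ k0" using real_arch_pow[of 2 y] by auto
  define k where "k = (LEAST k. y < 2 ^ k)"
  have k: "y < 2 ^ k" unfolding k_def using \<open>y < 2 ^ k0\<close> by (rule LeastI)
  then have "k \<noteq> 0" using assms by (intro notI) simp
  then obtain n where n: "k = Suc n" using not0_implies_Suc by blast
  have "\<not> y < 2 ^ n" using not_less_Least[of n "\<lambda>k. y < 2 ^ k"] n k_def by auto
  with that[of n] k n show thesis by auto
qed

text \<open>A bound for the integral of \<open>|x|^(- s)\<close> outside the ball of radius \<open>R\<close>; what matters is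
  that it grows no faster than \<open>1 / (s - N)\<close> as \<open>s\<close> decreases to \<open>N\<close>.\<close>

definition power_tail_bound :: "nat \<Rightarrow> real \<Rightarrow> real \<Rightarrow> real" where
  "power_tail_bound N s R =
     unit_ball_vol (real N) * 2 ^ N * R powr (real N - s) * (1 + 2 / (s - real N))"

text \<open>On the dyadic shell between the radii \<open>2^n R\<close> and \<open>2^(n + 1) R\<close> the integrand is at most its value
  at the inner radius, and the shell is contained in the outer ball. The resulting bounds form
  a geometric series with ratio \<open>2^(N - s)\<close>.\<close>

lemma nn_integral_power_tail_le:
  fixes s R :: real
  assumes s: "s > real DIM('a::euclidean_space)" and R: "R > 0"
  shows "(\<integral>\<^sup>+(x::'a). ennreal (indicator (- ball 0 R) x * norm x powr (- s)) \<partial>lborel)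
         \<le> ennreal (power_tail_bound DIM('a) s R)"
proof -
  let ?N = "DIM('a)"
  define h where "h n x = ennreal ((2 ^ n * R) powr (- s)) * indicator (cball 0 (2 ^ Suc n * R)) x"
    for n :: nat and x :: 'a
  have [measurable]: "h n \<in> borel_measurable lborel" for n
    unfolding h_def by (intro borel_measurable_times_ennreal borel_measurable_const borel_measurable_indicator) simp
  have pw: "ennreal (indicator (- ball 0 R) x * norm x powr (- s)) \<le> (\<Sum>n. h n x)" for x :: 'a
  proof (cases "norm x \<ge> R")
    case True
    then have "1 \<le> norm x / R" using R by simp
    then obtain n where n: "2 ^ n \<le> norm x / R" "norm x / R < 2 ^ Suc n"
      by (rule ex_dyadic_scale)
    then have n': "2 ^ n * R \<le> norm x" "norm x \<le> 2 ^ Suc n * R"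
      using R by (simp_all add: field_simps)
    have "norm x powr (- s) \<le> (2 ^ n * R) powr (- s)"
      using n' R s by (intro powr_mono2') auto
    then have "ennreal (indicator (- ball 0 R) x * norm x powr (- s)) \<le> h n x"
      using n' True unfolding h_def by (auto simp: indicator_def intro!: ennreal_leI)
    also have "\<dots> \<le> (\<Sum>n. h n x)"
      using sum_le_suminf[of "\<lambda>n. h n x" "{n}"] by simp
    finally show ?thesis .
  qed (auto simp: indicator_def)
  define q where "q = 2 powr (- (s - ?N))"
  have q: "0 < q" "q < 1" "1 / (1 - q) \<le> 1 + 2 / (s - ?N)"
    using inverse_one_minus_two_powr_le[of "s - ?N"] s by (auto simp: q_def)
  define K where "K = unit_ball_vol (real ?N) * 2 ^ ?N * R powr (real ?N - s)"
  have K: "K \<ge> 0" by (simp add: K_def)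
  have term_eq: "integral\<^sup>N lborel (h n) = ennreal (K * q ^ n)" for n
  proof -
    have "integral\<^sup>N lborel (h n)
        = ennreal ((2 ^ n * R) powr (- s)) * emeasure lborel (cball 0 (2 ^ Suc n * R) :: 'a set)"
      unfolding h_def by (subst nn_integral_cmult_indicator) auto
    also have "\<dots> = ennreal ((2 ^ n * R) powr (- s) * (unit_ball_vol ?N * (2 ^ Suc n * R) ^ ?N))"
      using R by (subst emeasure_cball) (auto simp: ennreal_mult)
    also have "(2 ^ n * R) powr (- s) * (unit_ball_vol ?N * (2 ^ Suc n * R) ^ ?N)
        = unit_ball_vol ?N * 2 ^ ?N * ((2 ^ n * R) powr (- s) * (2 ^ n * R) ^ ?N)"
      by (simp add: power_mult_distrib)
    also have "(2 ^ n * R) powr (- s) * (2 ^ n * R) ^ ?N = (2 ^ n * R) powr (?N - s)"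
      using R by (subst powr_realpow[symmetric]) (auto simp: powr_add[symmetric])
    also have "\<dots> = (2 ^ n) powr (?N - s) * R powr (?N - s)"
      using R by (simp add: powr_mult)
    also have "(2 ^ n) powr (?N - s) = q ^ n"
      by (simp add: q_def powr_realpow[symmetric] powr_powr mult.commute)
    finally show ?thesis by (simp add: K_def mult_ac)
  qed
  have "(\<integral>\<^sup>+(x::'a). ennreal (indicator (- ball 0 R) x * norm x powr (- s)) \<partial>lborel)
        \<le> (\<integral>\<^sup>+x. (\<Sum>n. h n x) \<partial>lborel)"
    by (intro nn_integral_mono pw)
  also have "\<dots> = (\<Sum>n. ennreal (K * q ^ n))"
    by (subst nn_integral_suminf) (simp_all add: term_eq)
  also have "\<dots> = ennreal (K * (1 / (1 - q)))"
    using K q by (intro suminf_ennreal_eq sums_mult geometric_sums) auto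
  also have "\<dots> \<le> ennreal (power_tail_bound ?N s R)"
    unfolding power_tail_bound_def K_def[symmetric] using K q
    by (intro ennreal_leI mult_left_mono) auto
  finally show ?thesis .
qed

lemma norm_square_powr: "((norm x)\<^sup>2) powr a = norm x powr (2 * a)"
proof -
  have "(norm x)\<^sup>2 = norm x powr 2" by (simp add: powr_numeral)
  then show ?thesis by (simp only: powr_powr)
qed

text \<open>Inside the unit ball the integrand is at most \<open>1\<close>, outside it is dominated by a
  power with exponent below \<open>-N\<close>.\<close>

lemma integrable_one_plus_norm_square_powr:
  fixes p :: real
  assumes p: "2 * p > real DIM('a::euclidean_space)"
  shows "integrable lborel (\<lambda>x::'a. (1 + (norm x)\<^sup>2) powr (- p))"
proof (rule integrableI_bounded)
  show "(\<lambda>x::'a. (1 + (norm x)\<^sup>2) powr (- p)) \<in> borel_measurable lborel" by measurable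
  have p0: "p > 0" using p by (smt (verit) of_nat_0_le_iff)
  have pw: "ennreal (norm ((1 + (norm x)\<^sup>2) powr (- p)))
    \<le> indicator (ball 0 1) x + ennreal (indicator (- ball 0 1) x * norm x powr (- (2 * p)))"
    for x :: 'a
  proof (cases "norm x \<ge> 1")
    case True
    have "(1 + (norm x)\<^sup>2) powr (- p) \<le> ((norm x)\<^sup>2) powr (- p)"
      using True p0 by (intro powr_mono2') auto
    also have "\<dots> = norm x powr (- (2 * p))"
      by (simp add: norm_square_powr)
    finally show ?thesis using True
      by (auto simp: indicator_def intro!: ennreal_leI)
  next
    case False
    have "(1 + (norm x)\<^sup>2) powr (- p) \<le> 1 powr (- p)"
      using p0 by (intro powr_mono2') auto
    then show ?thesis using False by (auto simp: indicator_def ennreal_le_1)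
  qed
  have "(\<integral>\<^sup>+(x::'a). ennreal (norm ((1 + (norm x)\<^sup>2) powr (- p))) \<partial>lborel)
    \<le> (\<integral>\<^sup>+(x::'a). indicator (ball 0 1) x +
          ennreal (indicator (- ball 0 1) x * norm x powr (- (2 * p))) \<partial>lborel)"
    by (intro nn_integral_mono pw)
  also have "\<dots> = emeasure lborel (ball (0::'a) 1) +
      (\<integral>\<^sup>+(x::'a). ennreal (indicator (- ball 0 1) x * norm x powr (- (2 * p))) \<partial>lborel)"
    by (subst nn_integral_add) (auto intro!: borel_measurable_indicator)
  also have "\<dots> \<le> ennreal (unit_ball_vol DIM('a)) + ennreal (power_tail_bound DIM('a) (2 * p) 1)"
    using p by (intro add_mono nn_integral_power_tail_le) (auto simp: emeasure_ball)
  also have "\<dots> < \<infinity>" by simp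
  finally show "(\<integral>\<^sup>+(x::'a). ennreal (norm ((1 + (norm x)\<^sup>2) powr (- p))) \<partial>lborel) < \<infinity>" .
qed

definition unit_mass :: "'a::euclidean_space itself \<Rightarrow> real \<Rightarrow> real" where
  "unit_mass _ p = (\<integral>(x::'a). (1 + (norm x)\<^sup>2) powr (- p) \<partial>lborel)"

lemma unit_mass_pos:
  assumes "2 * p > real DIM('a::euclidean_space)"
  shows "unit_mass TYPE('a) p > 0"
proof -
  let ?f = "\<lambda>x::'a. (1 + (norm x)\<^sup>2) powr (- p)"
  have pos: "?f x > 0" for x :: 'a
    using add_pos_nonneg[of 1 "(norm x)\<^sup>2"] by simp
  have "unit_mass TYPE('a) p \<noteq> 0"
  proof
    assume "unit_mass TYPE('a) p = 0"
    then have "AE x::'a in lborel. ?f x = 0"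
      using integral_nonneg_eq_0_iff_AE[OF integrable_one_plus_norm_square_powr[OF assms]]
      by (simp add: unit_mass_def)
    then have "AE x::'a in lborel. False"
    proof eventually_elim
      case (elim x)
      then show ?case using pos[of x] by linarith
    qed
    then have "emeasure lborel (UNIV :: 'a set) = 0"
      by (simp add: eventually_False ae_filter_eq_bot_iff)
    then show False by simp
  qed
  moreover have "unit_mass TYPE('a) p \<ge> 0" unfolding unit_mass_def by simp
  ultimately show ?thesis by simp
qed

lemma has_bochner_integral_lborel_scaleR:
  fixes g :: "'a::euclidean_space \<Rightarrow> real"
  assumes c: "c > 0" and g: "has_bochner_integral lborel g J"
  shows "has_bochner_integral lborel (\<lambda>x. g (c *\<^sub>R x)) (J / c ^ DIM('a))"
proof -
  have [measurable]: "g \<in> borel_measurable borel"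
    using borel_measurable_has_bochner_integral[OF g] by simp
  have L: "(lborel :: 'a measure)
      = density (distr lborel borel (\<lambda>x. 0 + c *\<^sub>R x)) (\<lambda>_. ennreal (c ^ DIM('a)))"
    using lborel_affine[of c "0::'a"] c by simp
  have "integrable (density (distr lborel borel (\<lambda>x. 0 + c *\<^sub>R x)) (\<lambda>_. ennreal (c ^ DIM('a)))) g"
    using g unfolding L[symmetric] by (simp add: has_bochner_integral_iff)
  then have i: "integrable lborel (\<lambda>x. g (c *\<^sub>R x))"
    using c by (subst (asm) integrable_real_density) (auto simp: integrable_distr_eq)
  have "J = integral\<^sup>L (density (distr lborel borel (\<lambda>x. 0 + c *\<^sub>R x)) (\<lambda>_. ennreal (c ^ DIM('a)))) g"
    using g unfolding L[symmetric] by (simp add: has_bochner_integral_iff)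
  also have "\<dots> = c ^ DIM('a) * (\<integral>x. g (c *\<^sub>R x) \<partial>lborel)"
    using c by (subst integral_real_density) (auto simp: integral_distr)
  finally show ?thesis using i c by (simp add: has_bochner_integral_iff)
qed

section \<open>Mass of the Barenblatt profiles\<close>

lemma bar_alpha_eq: "N > 0 \<Longrightarrow> bar_alpha N m = 1 / (m - m_crit N)"
  by (cases "real N * m = real N - 2") (auto simp: bar_alpha_def m_crit_def field_simps)

lemma bar_beta_eq: "N > 0 \<Longrightarrow> bar_beta N m = 1 / (real N * (m - m_crit N))"
  by (simp add: bar_beta_def bar_alpha_eq)

definition bar_kappa :: "nat \<Rightarrow> real \<Rightarrow> real" where
  "bar_kappa N m = bar_beta N m * (1 - m) / (2 * m)"

lemma bar_kappa_eq: "N > 0 \<Longrightarrow> bar_kappa N m = (1 - m) / (2 * m * real N * (m - m_crit N))"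
  by (simp add: bar_kappa_def bar_beta_eq mult_ac)

text \<open>Above the critical exponent \<open>2 p\<close> exceeds \<open>N\<close>, but only by a multiple of \<open>m - m\<^sub>c\<close>. The exact
  excess fixes both the power of \<open>t\<close> in the pointwise estimate and the growth of the tail integral.\<close>

lemma fast_diffusion_exponents:
  assumes "N > 2" "m_crit N < m" "m < 1"
  shows "0 < m" "bar_kappa N m > 0" "2 / (1 - m) - real N = real N * (m - m_crit N) / (1 - m)"
    "2 * (1 / (1 - m)) > real N"
proof -
  show m: "0 < m" using assms by (auto simp: m_crit_def intro: le_less_trans[rotated])
  show "bar_kappa N m > 0" using assms m by (simp add: bar_kappa_eq)
  show *: "2 / (1 - m) - real N = real N * (m - m_crit N) / (1 - m)"
    using assms by (simp add: m_crit_def field_simps)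
  have "0 < real N * (m - m_crit N) / (1 - m)" using assms by simp
  then show "2 * (1 / (1 - m)) > real N" using * by simp
qed

text \<open>The substitution \<open>y = c x\<close> with \<open>c\<^sup>2 = (\<kappa> / C) t^(- 2 \<beta>)\<close> reduces the profile to
  the function defining \<open>unit_mass\<close>. Its Jacobian contributes \<open>t^(N \<beta>) = t^\<alpha>\<close>, which cancels the
  prefactor, so the mass does not depend on \<open>t\<close>.\<close>

lemma has_bochner_integral_barenblatt_profile:
  fixes m t C :: real
  defines "p \<equiv> 1 / (1 - m)"
  assumes N: "CARD('n::finite) > 2" and m: "m_crit CARD('n) < m" "m < 1" and C: "C > 0" and t: "t > 0"
  shows "has_bochner_integral lborel (barenblatt_profile C m t :: real ^ 'n \<Rightarrow> real)
           (unit_mass TYPE(real ^ 'n) p * bar_kappa CARD('n) m powr (- real CARD('n) / 2)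
             * C powr - (p - real CARD('n) / 2))"
proof -
  let ?N = "real CARD('n)" and ?\<beta> = "bar_beta CARD('n) m" and ?\<alpha> = "bar_alpha CARD('n) m"
  let ?J = "unit_mass TYPE(real ^ 'n) p"
  define k where "k = bar_kappa CARD('n) m"
  have k: "k > 0" using fast_diffusion_exponents[OF N m] by (simp add: k_def)
  have p: "2 * p > ?N" using fast_diffusion_exponents[OF N m] by (simp add: p_def)
  define c where "c = (k / C) powr (1/2) * t powr (- ?\<beta>)"
  have c: "c > 0" using k C t by (simp add: c_def)
  have c2: "c\<^sup>2 = k / C / t powr (2 * ?\<beta>)"
    using k C t by (simp add: c_def power_mult_distrib powr_power powr_minus divide_simps)
  have cN: "c ^ CARD('n) = k powr (?N / 2) * C powr (- ?N / 2) * t powr (- ?\<alpha>)"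
  proof -
    have "c ^ CARD('n) = (k / C) powr (?N / 2) * t powr (- (?N * ?\<beta>))"
      using c k C t by (simp add: c_def power_mult_distrib powr_power mult.commute)
    also have "?N * ?\<beta> = ?\<alpha>" using N by (simp add: bar_beta_def)
    finally show ?thesis using k C by (simp add: powr_divide powr_minus divide_simps)
  qed
  have "has_bochner_integral lborel (\<lambda>x::real^'n. (1 + (norm x)\<^sup>2) powr (- p)) ?J"
    using integrable_one_plus_norm_square_powr[of p, where 'a = "real ^ 'n"] p
    by (simp add: has_bochner_integral_iff unit_mass_def)
  from has_bochner_integral_lborel_scaleR[OF c this]
  have "has_bochner_integral lborel (\<lambda>x::real^'n. (t powr (- ?\<alpha>) * C powr (- p)) *
      (1 + (norm (c *\<^sub>R x))\<^sup>2) powr (- p)) ((t powr (- ?\<alpha>) * C powr (- p)) * (?J / c ^ CARD('n)))"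
    by (intro has_bochner_integral_mult_right) simp
  moreover have "(t powr (- ?\<alpha>) * C powr (- p)) * (1 + (norm (c *\<^sub>R x))\<^sup>2) powr (- p)
      = barenblatt_profile C m t x" for x :: "real ^ 'n"
  proof -
    have "C powr (- p) * (1 + (norm (c *\<^sub>R x))\<^sup>2) powr (- p)
        = (C * (1 + c\<^sup>2 * (norm x)\<^sup>2)) powr (- p)"
      using C by (subst powr_mult) (auto simp: power_mult_distrib)
    also have "C * (1 + c\<^sup>2 * (norm x)\<^sup>2) = C + k * ((norm x)\<^sup>2 / t powr (2 * ?\<beta>))"
      unfolding c2 using C by (simp add: field_simps)
    finally show ?thesis
      by (simp add: barenblatt_profile_def p_def k_def bar_kappa_def mult.assoc)
  qed
  moreover have "(t powr (- ?\<alpha>) * C powr (- p)) * (?J / c ^ CARD('n))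
      = ?J * k powr (- ?N / 2) * C powr - (p - ?N / 2)"
  proof -
    have "C powr - (p - ?N / 2) = C powr (- p) / C powr (- ?N / 2)"
      by (simp flip: powr_diff)
    moreover have "k powr (- ?N / 2) = 1 / k powr (?N / 2)"
      by (simp add: powr_minus divide_simps)
    ultimately show ?thesis unfolding cN using k C t by simp
  qed
  ultimately show ?thesis by (simp add: k_def)
qed

text \<open>The mass is a constant times a negative power of \<open>C\<close>, so it can be inverted explicitly; hence
  the definite description defining \<open>barenblatt_const\<close> denotes.\<close>

lemma barenblatt_const:
  assumes N: "CARD('n::finite) > 2" and m: "m_crit CARD('n) < m" "m < 1" and M: "M > 0"
  shows "barenblatt_const TYPE('n) m M > 0"
    and "t > 0 \<Longrightarrow> has_bochner_integral lborel (barenblatt m M t :: real ^ 'n \<Rightarrow> real) M"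
proof -
  define p where "p = 1 / (1 - m)"
  define d where "d = p - real CARD('n) / 2"
  define A where "A = unit_mass TYPE(real ^ 'n) p * bar_kappa CARD('n) m powr (- real CARD('n) / 2)"
  note e = fast_diffusion_exponents[OF N m]
  have d: "d > 0" using e(4) by (simp add: d_def p_def)
  have A: "A > 0" using unit_mass_pos[of p, where 'a = "real ^ 'n"] e by (simp add: A_def p_def)
  have mass: "has_bochner_integral lborel (barenblatt_profile C m t :: real ^ 'n \<Rightarrow> real) (A * C powr - d)"
    if "C > 0" "t > 0" for C t
    using has_bochner_integral_barenblatt_profile[OF N m that] by (simp add: A_def d_def p_def)
  let ?P = "\<lambda>C. C > 0 \<and>
      (\<forall>t>0. has_bochner_integral lborel (barenblatt_profile C m t :: real ^ 'n \<Rightarrow> real) M)"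
  have "\<exists>!C. ?P C"
  proof (rule ex1I)
    have "A * ((M / A) powr (- 1 / d)) powr - d = M"
      using A M d by (simp add: powr_powr)
    then show "?P ((M / A) powr (- 1 / d))"
      using mass[of "(M / A) powr (- 1 / d)"] A M by auto
  next
    fix C assume C: "?P C"
    then have "A * C powr - d = M"
      using mass[of C 1] has_bochner_integral_eq by (metis zero_less_one)
    then have "M / A = C powr - d" using A by (simp add: field_simps)
    then show "C = (M / A) powr (- 1 / d)" using C d by (simp add: powr_powr)
  qed
  from theI'[OF this] have *: "?P (barenblatt_const TYPE('n) m M)"
    unfolding barenblatt_const_def .
  show "barenblatt_const TYPE('n) m M > 0" using * by blast
  show "t > 0 \<Longrightarrow> has_bochner_integral lborel (barenblatt m M t :: real ^ 'n \<Rightarrow> real) M"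
    unfolding barenblatt_def using * by blast
qed

lemma barenblatt_nonneg: "0 \<le> barenblatt m M t x"
  by (simp add: barenblatt_def barenblatt_profile_def)

section \<open>The pointwise estimate\<close>

text \<open>What remains of \<open>\<kappa>^(- p)\<close> once the factor \<open>m - m\<^sub>c\<close> is split off; unlike \<open>\<kappa>\<close> itself
  it is continuous at \<open>m\<^sub>c\<close>.\<close>

definition bar_coeff :: "nat \<Rightarrow> real \<Rightarrow> real" where
  "bar_coeff N m = (2 * m * real N / (1 - m)) powr (1 / (1 - m))"

text \<open>The constant \<open>C > 0\<close> is discarded. It alone carries the dependence on the mass, so the bound holds
  for all masses at once.\<close>

lemma barenblatt_le:
  fixes x :: "real ^ 'n::finite"
  assumes N: "CARD('n) > 2" and m: "m_crit CARD('n) < m" "m < 1" and M: "M > 0" and t: "t > 0"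
    and x: "x \<noteq> 0"
  shows "barenblatt m M t x \<le> bar_coeff CARD('n) m * (m - m_crit CARD('n)) powr (1 / (1 - m))
           * norm x powr (- 2 / (1 - m)) * t powr (1 / (1 - m))"
proof -
  let ?N = "real CARD('n)" and ?\<beta> = "bar_beta CARD('n) m" and ?\<alpha> = "bar_alpha CARD('n) m"
  define e where "e = m - m_crit CARD('n)"
  define p where "p = 1 / (1 - m)"
  define k where "k = bar_kappa CARD('n) m"
  define C where "C = barenblatt_const TYPE('n) m M"
  note ex = fast_diffusion_exponents[OF N m]
  have e: "e > 0" and p: "p > 0" and k: "k > 0" and C: "C > 0"
    using m ex barenblatt_const(1)[OF N m M] by (auto simp: e_def p_def k_def C_def)
  have "barenblatt m M t x = t powr (- ?\<alpha>) * (C + k * ((norm x)\<^sup>2 / t powr (2 * ?\<beta>))) powr (- p)"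
    by (simp add: barenblatt_def barenblatt_profile_def C_def k_def bar_kappa_def p_def mult.assoc)
  also have "\<dots> \<le> t powr (- ?\<alpha>) * (k * ((norm x)\<^sup>2 / t powr (2 * ?\<beta>))) powr (- p)"
    using p k C x t by (intro mult_left_mono powr_mono2') auto
  also have "(k * ((norm x)\<^sup>2 / t powr (2 * ?\<beta>))) powr (- p)
      = k powr (- p) * norm x powr (- (2 * p)) * t powr (2 * ?\<beta> * p)"
  proof -
    show ?thesis using k x t
      by (simp add: norm_square_powr powr_mult powr_divide powr_powr powr_minus divide_simps)
  qed
  also have "t powr (- ?\<alpha>) * (k powr (- p) * norm x powr (- (2 * p)) * t powr (2 * ?\<beta> * p))
      = k powr (- p) * norm x powr (- (2 * p)) * t powr (2 * ?\<beta> * p - ?\<alpha>)"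
    using t by (simp add: powr_diff powr_minus divide_simps)
  also have "2 * ?\<beta> * p - ?\<alpha> = p"
  proof -
    have "2 * p = ?N + ?N * e * p" using ex(3) by (simp add: p_def e_def)
    then have "2 * p / (?N * e) = 1 / e + p" using N e by (simp add: field_simps)
    then show ?thesis using N by (simp add: bar_beta_eq bar_alpha_eq e_def)
  qed
  also have "k powr (- p) = bar_coeff CARD('n) m * e powr p"
  proof -
    have "k powr (- p) = (1 / k) powr p" using k by (simp add: powr_minus powr_divide divide_simps)
    also have "1 / k = (2 * m * ?N / (1 - m)) * e"
      using N by (simp add: k_def bar_kappa_eq e_def)
    also have "((2 * m * ?N / (1 - m)) * e) powr p = bar_coeff CARD('n) m * e powr p"
      unfolding bar_coeff_def p_def by (rule powr_mult)
    finally show ?thesis .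
  qed
  finally show ?thesis by (simp add: p_def e_def)
qed

lemma m_crit_bounds: "N > 2 \<Longrightarrow> 0 < m_crit N" "N > 2 \<Longrightarrow> m_crit N < 1"
  by (auto simp: m_crit_def)

lemma eventually_fast_diffusion_range:
  assumes "N > 2"
  shows "\<forall>\<^sub>F m in at_right (m_crit N). m_crit N < m \<and> m < 1"
  using eventually_at_right_real[OF m_crit_bounds(2)[OF assms]]
  by eventually_elim auto

lemma tendsto_bar_coeff:
  assumes "N > 2"
  shows "(bar_coeff N \<longlongrightarrow> bar_coeff N (m_crit N)) (at_right (m_crit N))"
  unfolding bar_coeff_def using m_crit_bounds[OF assms] assms
  by (intro tendsto_intros) auto

lemma one_minus_m_crit: "N > 0 \<Longrightarrow> 1 - m_crit N = 2 / real N"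
  by (simp add: m_crit_def field_simps)

text \<open>The exponent tends to \<open>N / 2 - a\<close>. The choice \<open>a = 0\<close> gives the decay of the pointwise estimate;
  \<open>a = 1\<close>, possible for \<open>N > 2\<close>, gives the decay of the tail, where one power of \<open>m - m\<^sub>c\<close> is lost.\<close>

lemma tendsto_excess_powr:
  assumes N: "N > 2" and "a < real N / 2"
  shows "((\<lambda>m. (m - m_crit N) powr (1 / (1 - m) - a)) \<longlongrightarrow> 0) (at_right (m_crit N))"
proof -
  have e: "((\<lambda>m. m - m_crit N) \<longlongrightarrow> m_crit N - m_crit N) (at_right (m_crit N))"
    by (intro tendsto_intros)
  have p: "((\<lambda>m. 1 / (1 - m) - a) \<longlongrightarrow> 1 / (1 - m_crit N) - a) (at_right (m_crit N))"
    using m_crit_bounds[OF N] by (intro tendsto_intros) auto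
  have "\<forall>\<^sub>F m in at_right (m_crit N). 0 \<le> m - m_crit N"
    using eventually_fast_diffusion_range[OF N] by eventually_elim auto
  then have "((\<lambda>m. (m - m_crit N) powr (1 / (1 - m) - a)) \<longlongrightarrow>
      (m_crit N - m_crit N) powr (1 / (1 - m_crit N) - a)) (at_right (m_crit N))"
    using assms by (intro tendsto_powr'[OF e p] disjI2 conjI) (auto simp: one_minus_m_crit)
  then show ?thesis by simp
qed

section \<open>Vanishing tails\<close>

lemma barenblatt_tail_le:
  assumes N: "CARD('n::finite) > 2" and m: "m_crit CARD('n) < m" "m < 1" and M: "M > 0" and t: "t > 0"
    and R: "R > 0"
  shows "(\<integral>(x::real^'n). indicator (- ball 0 R) x * barenblatt m M t x \<partial>lborel)
     \<le> bar_coeff CARD('n) m * (m - m_crit CARD('n)) powr (1 / (1 - m)) * t powr (1 / (1 - m))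
        * power_tail_bound CARD('n) (2 / (1 - m)) R"
proof -
  let ?s = "2 / (1 - m)"
  define D where "D = bar_coeff CARD('n) m * (m - m_crit CARD('n)) powr (1 / (1 - m)) * t powr (1 / (1 - m))"
  let ?T = "power_tail_bound CARD('n) ?s R"
  have D: "D \<ge> 0" by (simp add: D_def bar_coeff_def)
  have s: "?s > real CARD('n)" using fast_diffusion_exponents(4)[OF N m] by simp
  then have T: "?T \<ge> 0" by (simp add: power_tail_bound_def)
  have [measurable]: "(barenblatt m M t :: real ^ 'n \<Rightarrow> real) \<in> borel_measurable borel"
    using borel_measurable_has_bochner_integral[OF barenblatt_const(2)[OF N m M t]] by simp
  have pw: "indicator (- ball 0 R) x * barenblatt m M t x
      \<le> D * (indicator (- ball 0 R) x * norm x powr (- ?s))" for x :: "real ^ 'n"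
    using barenblatt_le[OF N m M t, of x] R by (cases "x = 0") (auto simp: indicator_def D_def mult_ac)
  have "(\<integral>\<^sup>+(x::real^'n). ennreal (indicator (- ball 0 R) x * barenblatt m M t x) \<partial>lborel)
      \<le> (\<integral>\<^sup>+(x::real^'n). ennreal D * ennreal (indicator (- ball 0 R) x * norm x powr (- ?s)) \<partial>lborel)"
    using pw D by (intro nn_integral_mono) (auto simp: ennreal_mult[symmetric] intro!: ennreal_leI)
  also have "\<dots> = ennreal D * (\<integral>\<^sup>+(x::real^'n). ennreal (indicator (- ball 0 R) x * norm x powr (- ?s)) \<partial>lborel)"
    by (subst nn_integral_cmult) auto
  also have "\<dots> \<le> ennreal D * ennreal ?T"
    using nn_integral_power_tail_le[where 'a = "real ^ 'n", of ?s R] s R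
    by (intro mult_left_mono) auto
  also have "\<dots> = ennreal (D * ?T)" using D T by (simp add: ennreal_mult)
  finally have "enn2real (\<integral>\<^sup>+(x::real^'n). ennreal (indicator (- ball 0 R) x * barenblatt m M t x) \<partial>lborel) \<le> D * ?T"
    using D T by (intro enn2real_leI) auto
  then show ?thesis
    by (subst integral_eq_nn_integral) (auto simp: D_def barenblatt_nonneg)
qed

text \<open>The factor \<open>1 + 2 / (2 p - N)\<close> of the tail bound costs one power of \<open>m - m\<^sub>c\<close>; because \<open>p\<close>
  tends to \<open>N / 2 > 1\<close>, a positive power is left.\<close>

lemma tendsto_barenblatt_tail:
  assumes N: "CARD('n::finite) > 2" and M: "M > 0" and t: "t > 0" and R: "R > 0"
  shows "((\<lambda>m. \<integral>(x::real^'n). indicator (- ball 0 R) x * barenblatt m M t x \<partial>lborel) \<longlongrightarrow> 0)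
           (at_right (m_crit CARD('n)))"
proof -
  let ?N = "CARD('n)" and ?F = "at_right (m_crit CARD('n))"
  let ?G = "\<lambda>m. bar_coeff ?N m * t powr (1 / (1 - m)) * (unit_ball_vol ?N * 2 ^ ?N * R powr (real ?N - 2 / (1 - m)))
      * ((m - m_crit ?N) powr (1 / (1 - m) - 0)
         + 2 * (1 - m) / real ?N * (m - m_crit ?N) powr (1 / (1 - m) - 1))"
  have "(?G \<longlongrightarrow> bar_coeff ?N (m_crit ?N) * t powr (1 / (1 - m_crit ?N))
      * (unit_ball_vol ?N * 2 ^ ?N * R powr (real ?N - 2 / (1 - m_crit ?N)))
      * (0 + 2 * (1 - m_crit ?N) / real ?N * 0)) ?F"
    using m_crit_bounds[OF N] N t R
    by (intro tendsto_intros tendsto_bar_coeff tendsto_excess_powr) auto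
  then have G: "(?G \<longlongrightarrow> 0) ?F" by simp
  have upper: "\<forall>\<^sub>F m in ?F. (\<integral>(x::real^'n). indicator (- ball 0 R) x * barenblatt m M t x \<partial>lborel) \<le> ?G m"
    using eventually_fast_diffusion_range[OF N]
  proof eventually_elim
    case (elim m)
    then have m: "m_crit ?N < m" "m < 1" by auto
    have tail_factor: "2 / (2 / (1 - m) - real ?N) = 2 * (1 - m) / real ?N / (m - m_crit ?N)"
      unfolding fast_diffusion_exponents(3)[OF N m] by simp
    have excess: "(m - m_crit ?N) powr (1 / (1 - m) - 0)
         + 2 * (1 - m) / real ?N * (m - m_crit ?N) powr (1 / (1 - m) - 1)
       = (m - m_crit ?N) powr (1 / (1 - m)) * (1 + 2 * (1 - m) / real ?N / (m - m_crit ?N))"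
      using m by (simp add: powr_diff distrib_left)
    have "bar_coeff ?N m * (m - m_crit ?N) powr (1 / (1 - m)) * t powr (1 / (1 - m))
        * power_tail_bound ?N (2 / (1 - m)) R = ?G m"
      unfolding power_tail_bound_def excess tail_factor by (simp only: mult_ac)
    then show ?case using barenblatt_tail_le[OF N m M t R] by (simp only:)
  qed
  have lower: "\<forall>\<^sub>F m in ?F. 0 \<le> (\<integral>(x::real^'n). indicator (- ball 0 R) x * barenblatt m M t x \<partial>lborel)"
    by (auto simp: barenblatt_nonneg)
  show ?thesis by (rule tendsto_sandwich[OF lower upper tendsto_const G])
qed

section \<open>Concentration at the origin\<close>

text \<open>Subtracting \<open>f 0\<close> from the test function reduces the claim to two regions: near the origin
  \<open>f - f 0\<close> is small and the total mass is \<open>M\<close>; elsewhere \<open>f - f 0\<close> is merely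
  bounded, but the mass tends to \<open>0\<close>.\<close>

lemma weak_conv_measures_point_mass:
  fixes g :: "'i \<Rightarrow> 'a::euclidean_space \<Rightarrow> real"
  assumes M: "M \<ge> 0"
    and nonneg: "\<And>i x. 0 \<le> g i x"
    and mass: "\<forall>\<^sub>F i in F. has_bochner_integral lborel (g i) M"
    and tail: "\<And>R. R > 0 \<Longrightarrow> ((\<lambda>i. \<integral>x. indicator (- ball 0 R) x * g i x \<partial>lborel) \<longlongrightarrow> 0) F"
  shows "weak_conv_measures (\<lambda>i. density lborel (\<lambda>x. ennreal (g i x)))
           (scale_measure (ennreal M) (return borel 0)) F"
proof -
  let ?\<delta> = "scale_measure (ennreal M) (return borel (0::'a))"
  have \<delta>: "?\<delta> = density (return borel 0) (\<lambda>_. ennreal M)"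
    by (rule measure_eqI) (auto simp: emeasure_density_const)
  have "\<forall>\<^sub>F i in F. finite_measure (density lborel (\<lambda>x. ennreal (g i x)))
      \<and> sets (density lborel (\<lambda>x. ennreal (g i x))) = sets borel"
    using mass
  proof eventually_elim
    case (elim i)
    have [measurable]: "g i \<in> borel_measurable borel"
      using borel_measurable_has_bochner_integral[OF elim] by simp
    have "emeasure (density lborel (\<lambda>x. ennreal (g i x))) UNIV = ennreal M"
      using elim nonneg by (subst emeasure_density)
        (auto simp: has_bochner_integral_iff nn_integral_eq_integral)
    then show ?case by (auto intro!: finite_measureI)
  qed
  moreover have "finite_measure ?\<delta>"
    by (rule finite_measureI) (simp add: space_scale_measure)
  moreover have "((\<lambda>i. integral\<^sup>L (density lborel (\<lambda>x. ennreal (g i x))) f) \<longlongrightarrow> integral\<^sup>L ?\<delta> f) F"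
    if f: "continuous_on UNIV f \<and> bounded (range f)" for f :: "'a \<Rightarrow> real"
  proof -
    have [measurable]: "f \<in> borel_measurable borel"
      using f by (auto intro: borel_measurable_continuous_onI)
    obtain K where K: "K > 0" "\<And>x. \<bar>f x\<bar> \<le> K"
      using f unfolding bounded_pos by auto
    have lim: "integral\<^sup>L ?\<delta> f = f 0 * M"
      unfolding \<delta> using M by (subst integral_real_density) (auto simp: integral_return)
    have "((\<lambda>i. integral\<^sup>L (density lborel (\<lambda>x. ennreal (g i x))) f) \<longlongrightarrow> f 0 * M) F"
    proof (rule tendstoI)
      fix e :: real assume e: "e > 0"
      (* M + 1 instead of M, since the mass M may be 0 here *)
      define e' where "e' = e / (2 * (M + 1))"
      have e': "e' > 0" "e' * M < e / 2"
        using e M by (auto simp: e'_def field_simps)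
      have "isCont f 0" using f by (simp add: continuous_on_eq_continuous_at)
      then obtain R where R: "R > 0" "\<And>x. norm x < R \<Longrightarrow> \<bar>f x - f 0\<bar> < e'"
        using e'(1) unfolding continuous_at_eps_delta by (auto simp: dist_norm)
      have "\<forall>\<^sub>F i in F. (\<integral>x. indicator (- ball 0 R) x * g i x \<partial>lborel) < e / (4 * K)"
        using order_tendstoD(2)[OF tail[OF R(1)], of "e / (4 * K)"] e K by simp
      then show "\<forall>\<^sub>F i in F. dist (integral\<^sup>L (density lborel (\<lambda>x. ennreal (g i x))) f) (f 0 * M) < e"
        using mass
      proof eventually_elim
        case (elim i)
        let ?h = "\<lambda>x. indicator (- ball 0 R) x * g i x"
        have [measurable]: "g i \<in> borel_measurable borel"
          using borel_measurable_has_bochner_integral[OF elim(2)] by simp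
        have gi: "integrable lborel (g i)" "integral\<^sup>L lborel (g i) = M"
          using elim(2) by (auto simp: has_bochner_integral_iff)
        have hi: "integrable lborel ?h"
          by (rule Bochner_Integration.integrable_bound[OF gi(1)]) (auto simp: indicator_def)
        have fi: "integrable lborel (\<lambda>x. g i x * f x)"
          by (rule Bochner_Integration.integrable_bound[of _ "\<lambda>x. K * g i x"])
            (use gi nonneg K in \<open>auto simp: abs_mult mult.commute[of K] intro!: mult_left_mono AE_I2\<close>)
        have "integral\<^sup>L (density lborel (\<lambda>x. ennreal (g i x))) f - f 0 * M
            = (\<integral>x. g i x * f x \<partial>lborel) - (\<integral>x. g i x * f 0 \<partial>lborel)"
          using gi nonneg by (subst integral_real_density) (auto simp: mult.commute)
        also have "\<dots> = (\<integral>x. g i x * (f x - f 0) \<partial>lborel)"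
          using gi fi by (subst Bochner_Integration.integral_diff[symmetric]) (auto simp: algebra_simps)
        finally have "dist (integral\<^sup>L (density lborel (\<lambda>x. ennreal (g i x))) f) (f 0 * M)
            = \<bar>\<integral>x. g i x * (f x - f 0) \<partial>lborel\<bar>" by (simp add: dist_real_def)
        also have "\<dots> \<le> (\<integral>x. \<bar>g i x * (f x - f 0)\<bar> \<partial>lborel)"
          by (rule integral_abs_bound)
        also have "\<dots> \<le> (\<integral>x. e' * g i x + 2 * K * ?h x \<partial>lborel)"
        proof (rule integral_mono)
          show "integrable lborel (\<lambda>x. \<bar>g i x * (f x - f 0)\<bar>)"
            using gi fi by (auto simp: right_diff_distrib)
          show "integrable lborel (\<lambda>x. e' * g i x + 2 * K * ?h x)"
            using gi hi by auto
          fix x :: 'a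
          have "\<bar>f x - f 0\<bar> \<le> e' + 2 * K * indicator (- ball 0 R) x"
          proof (cases "norm x < R")
            case True
            then show ?thesis using R(2)[of x] by (simp add: indicator_def)
          next
            case False
            then show ?thesis using K(2)[of x] K(2)[of 0] e' by (simp add: indicator_def)
          qed
          then have "g i x * \<bar>f x - f 0\<bar> \<le> g i x * (e' + 2 * K * indicator (- ball 0 R) x)"
            using nonneg by (rule mult_left_mono)
          moreover have "\<bar>g i x * (f x - f 0)\<bar> = g i x * \<bar>f x - f 0\<bar>"
            using nonneg by (simp add: abs_mult)
          ultimately show "\<bar>g i x * (f x - f 0)\<bar> \<le> e' * g i x + 2 * K * ?h x"
            by (simp only: distrib_left mult_ac)
        qed
        also have "\<dots> = e' * M + 2 * K * integral\<^sup>L lborel ?h"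
          using gi hi by simp
        also have "\<dots> < e / 2 + 2 * K * (e / (4 * K))"
          using e' elim(1) K by (intro add_less_le_mono mult_left_mono) auto
        also have "\<dots> = e" using K by simp
        finally show ?case .
      qed
    qed
    then show ?thesis using lim by simp
  qed
  ultimately show ?thesis unfolding weak_conv_measures_def by simp
qed

theorem theorem8p1:
  assumes "CARD('n::finite) > 2"
  shows
    "(\<forall>M>0. \<forall>t>0.
        weak_conv_measures
          (\<lambda>m. density lborel (\<lambda>x :: real ^ 'n. ennreal (barenblatt m M t x)))
          (scale_measure (ennreal M) (return borel 0))
          (at_right (m_crit CARD('n)))) \<and>
     (\<forall>M>0. \<forall>t>0. \<forall>R>0.
        uniform_limit (- ball (0 :: real ^ 'n) R)
          (\<lambda>m. barenblatt m M t) (\<lambda>_. 0) (at_right (m_crit CARD('n)))) \<and>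
     (\<exists>C>0. \<forall>\<^sub>F m in at_right (m_crit CARD('n)).
        \<forall>M>0. \<forall>t>0. \<forall>x :: real ^ 'n. x \<noteq> 0 \<longrightarrow>
          barenblatt m M t x
            \<le> C * (m - m_crit CARD('n)) powr (1 / (1 - m))
                * norm x powr (- 2 / (1 - m)) * t powr (1 / (1 - m)))"
proof (intro conjI allI impI)
  let ?N = "CARD('n)" and ?F = "at_right (m_crit CARD('n))"
  note range = eventually_fast_diffusion_range[OF assms]
  fix M t :: real assume M: "M > 0" and t: "t > 0"
  show "weak_conv_measures
          (\<lambda>m. density lborel (\<lambda>x :: real ^ 'n. ennreal (barenblatt m M t x)))
          (scale_measure (ennreal M) (return borel 0)) ?F"
  proof (rule weak_conv_measures_point_mass)
    show "\<forall>\<^sub>F m in ?F. has_bochner_integral lborel (barenblatt m M t :: real ^ 'n \<Rightarrow> real) M"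
      using range by eventually_elim (use barenblatt_const(2)[OF assms] M t in blast)
  qed (use M t assms tendsto_barenblatt_tail barenblatt_nonneg in auto)
  fix R :: real assume R: "R > 0"
  let ?G = "\<lambda>m. bar_coeff ?N m * (m - m_crit ?N) powr (1 / (1 - m) - 0)
      * R powr (- 2 / (1 - m)) * t powr (1 / (1 - m))"
  have "(?G \<longlongrightarrow> bar_coeff ?N (m_crit ?N) * 0
      * R powr (- 2 / (1 - m_crit ?N)) * t powr (1 / (1 - m_crit ?N))) ?F"
    using m_crit_bounds[OF assms] assms t R
    by (intro tendsto_intros tendsto_bar_coeff tendsto_excess_powr) auto
  then have G: "(?G \<longlongrightarrow> 0) ?F" by simp
  show "uniform_limit (- ball (0 :: real ^ 'n) R) (\<lambda>m. barenblatt m M t) (\<lambda>_. 0) ?F"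
  proof (rule uniform_limitI)
    fix e :: real assume "e > 0"
    with G have "\<forall>\<^sub>F m in ?F. ?G m < e" by (rule order_tendstoD(2))
    then show "\<forall>\<^sub>F m in ?F. \<forall>x\<in>- ball (0 :: real ^ 'n) R. dist (barenblatt m M t x) 0 < e"
      using range
    proof eventually_elim
      case (elim m)
      then have m: "m_crit ?N < m" "m < 1" by auto
      show ?case
      proof
        fix x :: "real ^ 'n" assume "x \<in> - ball 0 R"
        then have x: "norm x \<ge> R" "x \<noteq> 0" using R by auto
        have "norm x powr (- 2 / (1 - m)) \<le> R powr (- 2 / (1 - m))"
          using x R m by (intro powr_mono2') auto
        then have "bar_coeff ?N m * (m - m_crit ?N) powr (1 / (1 - m))
            * norm x powr (- 2 / (1 - m)) * t powr (1 / (1 - m)) \<le> ?G m"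
          by (auto intro!: mult_right_mono mult_left_mono simp: bar_coeff_def)
        with barenblatt_le[OF assms m M t x(2)] elim(1)
        have "barenblatt m M t x < e" by linarith
        then show "dist (barenblatt m M t x) 0 < e" using barenblatt_nonneg[of m M t x] by simp
      qed
    qed
  qed
next
  let ?N = "CARD('n)" and ?F = "at_right (m_crit CARD('n))"
  let ?C = "bar_coeff ?N (m_crit ?N) + 1"
  have "\<forall>\<^sub>F m in ?F. bar_coeff ?N m < ?C"
    using order_tendstoD(2)[OF tendsto_bar_coeff[OF assms]] by simp
  then have "\<forall>\<^sub>F m in ?F. \<forall>M>0. \<forall>t>0. \<forall>x :: real ^ 'n. x \<noteq> 0 \<longrightarrow> barenblatt m M t x
      \<le> ?C * (m - m_crit ?N) powr (1 / (1 - m)) * norm x powr (- 2 / (1 - m)) * t powr (1 / (1 - m))"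
    using eventually_fast_diffusion_range[OF assms]
  proof eventually_elim
    case (elim m)
    then show ?case
      by (auto intro!: order_trans[OF barenblatt_le[OF assms]] mult_right_mono)
  qed
  moreover have "?C > 0" by (simp add: bar_coeff_def add_nonneg_pos)
  ultimately show "\<exists>C>0. \<forall>\<^sub>F m in ?F. \<forall>M>0. \<forall>t>0. \<forall>x :: real ^ 'n. x \<noteq> 0 \<longrightarrow> barenblatt m M t x
      \<le> C * (m - m_crit ?N) powr (1 / (1 - m)) * norm x powr (- 2 / (1 - m)) * t powr (1 / (1 - m))"
    by blast
qed

end
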